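(* Let $k \ge 3$, $\ell \ge 1$ and $n$ be integers satisfying $$\chi(\ell+k-1,k-1) + \ell + k - 1 \le n \le \binom{\ell+k-1}{k-1} + \ell + k - 1.$$ Then there exists a uniquely $\tau$-critical $k$-uniform hypergraph $H$ with $n$ vertices and $\tau(H) = \ell+1$.
   Context: The Johnson graph $J(m,j)$ has vertex set $\binom{[m]}{j}$, two $j$-sets being adjacent iff they intersect in exactly $j-1$ elements; $\chi(m,j)$ denotes the chromatic number of $J(m,j)$. A transversal of a hypergraph $G$ is a vertex subset meeting every edge; $\tau(G)$ is the minimum size of a transversal. $G$ is $\tau$-critical if $\tau(G-e) < \tau(G)$ for every edge $e$. $G$ is uniquely $\tau$-critical if it is $\tau$-critical and for every edge $e$, the hypergraph $G-e$ has a unique minimum transversal. *)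

theory Defs
  imports Complex_Main
begin

definition proper_colouring :: "'a set \<Rightarrow> ('a \<Rightarrow> 'a \<Rightarrow> bool) \<Rightarrow> nat \<Rightarrow> ('a \<Rightarrow> nat) \<Rightarrow> bool" where
  "proper_colouring V adj c f \<longleftrightarrow>
     f ` V \<subseteq> {..<c} \<and> (\<forall>x\<in>V. \<forall>y\<in>V. adj x y \<longrightarrow> f x \<noteq> f y)"

definition chromatic_number :: "'a set \<Rightarrow> ('a \<Rightarrow> 'a \<Rightarrow> bool) \<Rightarrow> nat" where
  "chromatic_number V adj = (LEAST c. \<exists>f. proper_colouring V adj c f)"

definition johnson_verts :: "nat \<Rightarrow> nat \<Rightarrow> nat set set" where
  "johnson_verts m j = {S. S \<subseteq> {1..m} \<and> card S = j}"

text \<open>Adjacency asks for an intersection of size \<open>j - 1\<close>. Writing this with \<open>Suc\<close> avoids truncated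
  subtraction, which would put a loop at the empty set when \<open>j = 0\<close>.\<close>

definition johnson_adj :: "nat \<Rightarrow> nat set \<Rightarrow> nat set \<Rightarrow> bool" where
  "johnson_adj j S T \<longleftrightarrow> Suc (card (S \<inter> T)) = j"

definition johnson_chi :: "nat \<Rightarrow> nat \<Rightarrow> nat" where
  "johnson_chi m j = chromatic_number (johnson_verts m j) (johnson_adj j)"

text \<open>A hypergraph is given by its vertex set \<open>V\<close> and edge set \<open>E\<close>. Deleting an edge \<open>e\<close> keeps
  all vertices and yields \<open>(V, E - {e})\<close>.\<close>

definition hypergraph :: "'a set \<Rightarrow> 'a set set \<Rightarrow> bool" where
  "hypergraph V E \<longleftrightarrow> finite V \<and> (\<forall>e\<in>E. e \<subseteq> V)"

definition uniform :: "nat \<Rightarrow> 'a set set \<Rightarrow> bool" where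
  "uniform k E \<longleftrightarrow> (\<forall>e\<in>E. card e = k)"

text \<open>Kept separate from \<open>hypergraph\<close> because deleting an edge may create isolated vertices.\<close>

definition no_isolated_vertices :: "'a set \<Rightarrow> 'a set set \<Rightarrow> bool" where
  "no_isolated_vertices V E \<longleftrightarrow> (\<forall>v\<in>V. \<exists>e\<in>E. v \<in> e)"

definition transversal :: "'a set \<Rightarrow> 'a set set \<Rightarrow> 'a set \<Rightarrow> bool" where
  "transversal V E T \<longleftrightarrow> T \<subseteq> V \<and> (\<forall>e\<in>E. T \<inter> e \<noteq> {})"

text \<open>The value is meaningful only when \<open>V\<close> is finite and a transversal exists, that is, when no
  edge is empty.\<close>

definition tau :: "'a set \<Rightarrow> 'a set set \<Rightarrow> nat" where
  "tau V E = (LEAST t. \<exists>T. transversal V E T \<and> card T = t)"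

definition minimum_transversal :: "'a set \<Rightarrow> 'a set set \<Rightarrow> 'a set \<Rightarrow> bool" where
  "minimum_transversal V E T \<longleftrightarrow> transversal V E T \<and> card T = tau V E"

definition tau_critical :: "'a set \<Rightarrow> 'a set set \<Rightarrow> bool" where
  "tau_critical V E \<longleftrightarrow> (\<forall>e\<in>E. tau V (E - {e}) < tau V E)"

definition uniquely_tau_critical :: "'a set \<Rightarrow> 'a set set \<Rightarrow> bool" where
  "uniquely_tau_critical V E \<longleftrightarrow>
     tau_critical V E \<and> (\<forall>e\<in>E. \<exists>!T. minimum_transversal V (E - {e}) T)"

end

theory Submission
  imports Defs
begin

text \<open>
  Put \<open>m = l + k - 1\<close> and colour the \<open>(k-1)\<close>-subsets of \<open>{1..m}\<close> properly, as vertices of the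
  Johnson graph, with exactly \<open>n - m\<close> colours. The colours become new vertices, and every
  \<open>(k-1)\<close>-subset \<open>S\<close> together with its colour is an edge. If \<open>T\<close> has at most \<open>l\<close> elements and meets
  all edges except possibly that of \<open>S\<close>, let \<open>B\<close> be the part of \<open>{1..m}\<close> outside \<open>T\<close>, so that
  \<open>B\<close> has at least \<open>k - 1\<close> elements. If \<open>B\<close> is contained in \<open>S\<close>, then \<open>T = {1..m} - S\<close>. Otherwise
  \<open>B\<close> contains a \<open>(k-2)\<close>-set \<open>R\<close> not contained in \<open>S\<close> (here \<open>k \<ge> 3\<close> is used); the sets
  \<open>R \<union> {b}\<close> with \<open>b\<close> in \<open>B - R\<close> form a clique, so their colours are distinct and all lie in \<open>T\<close>,
  which makes \<open>T\<close> too large.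
\<close>

text \<open>Splitting a colour class by giving one of its vertices a fresh colour refines the
  partition and adds one colour; this can be repeated until all vertices have different
  colours.\<close>

lemma refine_colouring:
  assumes "finite V" "card (f ` V) \<le> q" "q \<le> card V"
  shows "\<exists>g :: 'a \<Rightarrow> nat. g ` V = {..<q} \<and> (\<forall>x\<in>V. \<forall>y\<in>V. g x = g y \<longrightarrow> f x = f y)"
  using assms(2,3)
proof (induction q rule: dec_induct)
  case base
  obtain h where h: "bij_betw h (f ` V) {..<card (f ` V)}"
    using ex_bij_betw_finite_nat[of "f ` V"] \<open>finite V\<close> by (auto simp: lessThan_atLeast0)
  have "(h \<circ> f) ` V = {..<card (f ` V)}"
    using h by (simp add: bij_betw_def image_comp)
  moreover have "\<forall>x\<in>V. \<forall>y\<in>V. (h \<circ> f) x = (h \<circ> f) y \<longrightarrow> f x = f y"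
    using h by (auto simp: bij_betw_def inj_on_def)
  ultimately show ?case by blast
next
  case (step q)
  then obtain g where g: "g ` V = {..<q}" "\<forall>x\<in>V. \<forall>y\<in>V. g x = g y \<longrightarrow> f x = f y"
    by auto
  have "\<not> inj_on g V"
    using card_image[of g V] g(1) step.prems by auto
  then obtain x y where xy: "x \<in> V" "y \<in> V" "x \<noteq> y" "g x = g y"
    by (auto simp: inj_on_def)
  \<comment> \<open>\<open>y\<close> keeps the old colour of \<open>x\<close>, so recolouring
    \<open>x\<close> with \<open>q\<close> loses no colour.\<close>
  have "g ` (V - {x}) = g ` V"
    using xy by (auto simp: image_iff)
  then have "(g(x := q)) ` V = {..<Suc q}"
    using g(1) xy(1) by (auto simp: fun_upd_image lessThan_Suc)
  moreover have "g z \<noteq> q" if "z \<in> V" for z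
    using g(1) that by blast
  then have "\<forall>u\<in>V. \<forall>v\<in>V. (g(x := q)) u = (g(x := q)) v \<longrightarrow> f u = f v"
    using g(2) by (metis fun_upd_apply)
  ultimately show ?case by blast
qed

text \<open>Without loops an injective numbering of the vertices is proper, so the
  \<open>LEAST\<close> in \<open>chromatic_number\<close> is attained.\<close>

lemma chromatic_number_colouring:
  assumes "finite V" "\<And>x. x \<in> V \<Longrightarrow> \<not> adj x x"
  obtains f where "proper_colouring V adj (chromatic_number V adj) f"
proof -
  obtain h where "bij_betw h V {0..<card V}"
    using ex_bij_betw_finite_nat[OF assms(1)] by blast
  then have "proper_colouring V adj (card V) h"
    using assms(2) by (force simp: proper_colouring_def bij_betw_def inj_on_def)
  then have "\<exists>f. proper_colouring V adj (card V) f" by blast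
  then have "\<exists>f. proper_colouring V adj (chromatic_number V adj) f"
    unfolding chromatic_number_def by (rule LeastI[where P = "\<lambda>c. \<exists>f. proper_colouring V adj c f"])
  then show ?thesis using that by blast
qed

lemma finite_johnson_verts: "finite (johnson_verts m j)"
  unfolding johnson_verts_def by simp

lemma card_johnson_verts: "card (johnson_verts m j) = m choose j"
  unfolding johnson_verts_def using n_subsets[of "{1..m}" j] by simp

text \<open>Refining an optimal colouring preserves properness. Surjectivity will ensure that no
  colour vertex is isolated.\<close>

lemma surjective_johnson_colouring:
  assumes "johnson_chi m j \<le> q" "q \<le> m choose j"
  obtains f where "f ` johnson_verts m j = {..<q}"
    and "\<And>S T. S \<in> johnson_verts m j \<Longrightarrow> T \<in> johnson_verts m j \<Longrightarrow> johnson_adj j S T \<Longrightarrow> f S \<noteq> f T"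
proof -
  let ?V = "johnson_verts m j"
  have "\<not> johnson_adj j S S" if "S \<in> ?V" for S
    using that by (auto simp: johnson_adj_def johnson_verts_def)
  then obtain f where f: "proper_colouring ?V (johnson_adj j) (johnson_chi m j) f"
    unfolding johnson_chi_def using chromatic_number_colouring[OF finite_johnson_verts] by metis
  then have "card (f ` ?V) \<le> card {..<johnson_chi m j}"
    by (intro card_mono) (auto simp: proper_colouring_def)
  then obtain g where g: "g ` ?V = {..<q}" "\<forall>S\<in>?V. \<forall>T\<in>?V. g S = g T \<longrightarrow> f S = f T"
    using refine_colouring[OF finite_johnson_verts, of f m j q] assms card_johnson_verts by auto
  show ?thesis
    using that[OF g(1)] g(2) f unfolding proper_colouring_def by metis
qed

lemma tau_eqI:
  assumes "transversal V E T" "card T = t"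
    and "\<And>T'. transversal V E T' \<Longrightarrow> t \<le> card T'"
  shows "tau V E = t"
  unfolding tau_def using assms by (intro Least_equality) auto

text \<open>Colours start at 0, so the shift by \<open>m + 1\<close> puts the colour vertices
  directly after \<open>{1..m}\<close>.\<close>

definition edge :: "nat \<Rightarrow> (nat set \<Rightarrow> nat) \<Rightarrow> nat set \<Rightarrow> nat set" where
  "edge m f S = insert (m + 1 + f S) S"

lemma edge_Int_core: "S \<subseteq> {1..m} \<Longrightarrow> edge m f S \<inter> {1..m} = S"
  by (auto simp: edge_def)

text \<open>Bounding \<open>card T\<close> by \<open>l\<close>, instead of fixing it, lets this one
  fact give both the lower bounds on \<open>tau\<close> and the uniqueness of minimum
  transversals.\<close>

lemma small_transversal_eq:
  assumes m: "m + 1 = l + k" and k: "k \<ge> 3"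
    and proper: "\<And>S S'. S \<in> johnson_verts m (k - 1) \<Longrightarrow> S' \<in> johnson_verts m (k - 1) \<Longrightarrow>
        johnson_adj (k - 1) S S' \<Longrightarrow> f S \<noteq> f S'"
    and S: "S \<in> johnson_verts m (k - 1)"
    and T: "finite T" "card T \<le> l"
    and meets: "\<And>S'. S' \<in> johnson_verts m (k - 1) \<Longrightarrow> S' \<noteq> S \<Longrightarrow> T \<inter> edge m f S' \<noteq> {}"
  shows "T = {1..m} - S"
proof -
  define A where "A = T \<inter> {1..m}"
  define C where "C = T - {1..m}"
  define B where "B = {1..m} - A"
  have fin: "finite A" "finite C" "finite B"
    using T by (auto simp: A_def C_def B_def)
  have AC: "card A + card C = card T"
    unfolding A_def C_def using card_Int_Diff[OF T(1), of "{1..m}"] by (rule sym)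
  have "card A \<le> m"
    using card_mono[of "{1..m}" A] by (auto simp: A_def)
  moreover have "card B = m - card A"
    unfolding B_def by (subst card_Diff_subset) (auto simp: A_def)
  ultimately have B: "card B + card A = m" by simp
  have S': "S \<subseteq> {1..m}" "card S = k - 1" "finite S"
    using S finite_subset[of S "{1..m}"] by (auto simp: johnson_verts_def)
  show ?thesis
  proof (cases "B \<subseteq> S")
    case True
    have "card S \<le> card B" using B AC T(2) S'(2) m by linarith
    then have "B = S" using True S'(3) card_seteq by blast
    \<comment> \<open>Now \<open>card A = m - (k - 1) = l\<close>, which leaves no room in
      \<open>T\<close> for colour vertices.\<close>
    then have "card C = 0" using B AC T(2) S'(2) m k by simp
    then have "T = A" using fin by (auto simp: A_def C_def)
    moreover have "A = {1..m} - B" by (auto simp: A_def B_def)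
    ultimately show ?thesis using \<open>B = S\<close> by simp
  next
    case False
    then obtain x where x: "x \<in> B" "x \<notin> S" by auto
    have "k - 3 \<le> card (B - {x})"
      using x fin(3) B AC T(2) m k by simp
    then obtain R' where R': "R' \<subseteq> B - {x}" "card R' = k - 3" "finite R'"
      using obtain_subset_with_card_n by metis
    \<comment> \<open>Including \<open>x\<close> keeps every \<open>insert b R\<close> different
      from \<open>S\<close>, so \<open>T\<close> must meet its edge.\<close>
    define R where "R = insert x R'"
    have R: "R \<subseteq> B" "card R = k - 2" "finite R" "\<not> R \<subseteq> S"
      using R' x k by (auto simp: R_def card_insert_if)
    have vert: "insert b R \<in> johnson_verts m (k - 1)" if "b \<in> B - R" for b
      using that R k by (auto simp: johnson_verts_def B_def)
    let ?c = "\<lambda>b. m + 1 + f (insert b R)"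
    have "inj_on ?c (B - R)"
    proof (rule inj_onI)
      fix a b assume ab: "a \<in> B - R" "b \<in> B - R" "?c a = ?c b"
      show "a = b"
      proof (rule ccontr)
        assume "a \<noteq> b"
        then have "insert a R \<inter> insert b R = R" using ab by auto
        then have "johnson_adj (k - 1) (insert a R) (insert b R)"
          using R k by (simp add: johnson_adj_def)
        then show False using proper[OF vert vert] ab by auto
      qed
    qed
    moreover have "?c ` (B - R) \<subseteq> C"
    proof clarify
      fix b assume b: "b \<in> B" "b \<notin> R"
      have "T \<inter> edge m f (insert b R) \<noteq> {}"
        using meets[OF vert] b R by blast
      moreover have "T \<inter> insert b R = {}"
        using b R by (auto simp: A_def B_def)
      ultimately show "?c b \<in> C" by (auto simp: edge_def C_def)
    qed
    ultimately have "card (B - R) \<le> card C"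
      using card_inj_on_le fin by blast
    moreover have "card (B - R) = card B - (k - 2)"
      using R by (simp add: card_Diff_subset)
    \<comment> \<open>Here \<open>card (B - R) = l + 1 - card A\<close>, whereas
      \<open>card C \<le> l - card A\<close>.\<close>
    ultimately have False using B AC T(2) m k by linarith
    then show ?thesis ..
  qed
qed

theorem theorem6:
  fixes k l n :: nat
  assumes "k \<ge> 3" and "l \<ge> 1"
    and "johnson_chi (l + k - 1) (k - 1) + l + k - 1 \<le> n"
    and "n \<le> ((l + k - 1) choose (k - 1)) + l + k - 1"
  shows "\<exists>(V :: nat set) (E :: nat set set).
           hypergraph V E \<and> uniform k E \<and> no_isolated_vertices V E \<and> card V = n \<and>
           uniquely_tau_critical V E \<and> tau V E = l + 1"
proof -
  define m where "m = l + k - 1"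
  define q where "q = n - m"
  have m: "m + 1 = l + k" using assms(1) by (simp add: m_def)
  have q: "johnson_chi m (k - 1) \<le> q" "q \<le> m choose (k - 1)" "n = m + q"
    using assms by (auto simp: m_def q_def)
  let ?J = "johnson_verts m (k - 1)"
  obtain f where f: "f ` ?J = {..<q}"
    and proper: "\<And>S S'. S \<in> ?J \<Longrightarrow> S' \<in> ?J \<Longrightarrow> johnson_adj (k - 1) S S' \<Longrightarrow> f S \<noteq> f S'"
    using surjective_johnson_colouring[OF q(1,2)] by metis
  define V where "V = {1..n}"
  define E where "E = edge m f ` ?J"
  have J: "S \<subseteq> {1..m}" "card S = k - 1" "finite S" if "S \<in> ?J" for S
    using that finite_subset[of S "{1..m}"] by (auto simp: johnson_verts_def)
  have extend: "\<exists>S\<in>?J. W \<subseteq> S" if W: "W \<subseteq> {1..m}" "card W \<le> k - 1" for W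
  proof -
    have "k - 1 \<le> card {1..m}" using m assms(2) by simp
    then obtain S where "W \<subseteq> S" "S \<subseteq> {1..m}" "card S = k - 1"
      using exists_subset_between[OF W(2) _ W(1)] by blast
    then have "S \<in> ?J" by (simp add: johnson_verts_def)
    with \<open>W \<subseteq> S\<close> show ?thesis by blast
  qed
  \<comment> \<open>Hence deleting the edge of \<open>S\<close> keeps the edges of all other
    sets.\<close>
  have edge_inj: "S = S'" if "S \<in> ?J" "S' \<in> ?J" "edge m f S = edge m f S'" for S S'
    using that J(1) edge_Int_core by metis
  have edge_sub: "edge m f S \<subseteq> V" if "S \<in> ?J" for S
  proof -
    have "f S < q" using f that by auto
    then show ?thesis using J(1)[OF that] q(3) by (auto simp: edge_def V_def)
  qed
  have hyp: "hypergraph V E"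
    using edge_sub by (auto simp: hypergraph_def E_def V_def)
  have uni: "uniform k E"
  proof -
    have "card (edge m f S) = k" if "S \<in> ?J" for S
    proof -
      have "m + 1 + f S \<notin> S" using J(1)[OF that] by auto
      then show ?thesis using J[OF that] assms(1) by (simp add: edge_def)
    qed
    then show ?thesis by (auto simp: uniform_def E_def)
  qed
  have iso: "no_isolated_vertices V E"
    unfolding no_isolated_vertices_def
  proof
    fix v assume v: "v \<in> V"
    have "\<exists>S\<in>?J. v \<in> edge m f S"
    proof (cases "v \<le> m")
      case True
      then show ?thesis
        using extend[of "{v}"] v assms(1) by (auto simp: edge_def V_def)
    next
      case False
      then have "v - (m + 1) \<in> f ` ?J"
        using v q(3) f by (auto simp: V_def)
      then obtain S where "S \<in> ?J" "v - (m + 1) = f S" by auto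
      then have "v = m + 1 + f S" using False by linarith
      then show ?thesis using \<open>S \<in> ?J\<close> by (auto simp: edge_def)
    qed
    then show "\<exists>e\<in>E. v \<in> e" by (auto simp: E_def)
  qed
  have small: "T = {1..m} - S"
    if S: "S \<in> ?J" and T: "transversal V (E - {edge m f S}) T" "card T \<le> l" for S T
  proof (rule small_transversal_eq[OF m assms(1) proper S])
    show "finite T" using T(1) finite_subset by (auto simp: transversal_def V_def)
    show "T \<inter> edge m f S' \<noteq> {}" if "S' \<in> ?J" "S' \<noteq> S" for S'
      using T(1) that edge_inj[OF that(1) S] by (auto simp: transversal_def E_def)
  qed (use T(2) in auto)
  have compl: "transversal V (E - {edge m f S}) ({1..m} - S)" "card ({1..m} - S) = l"
    if S: "S \<in> ?J" for S
  proof -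
    have "({1..m} - S) \<inter> edge m f S' \<noteq> {}" if "S' \<in> ?J" "S' \<noteq> S" for S'
    proof -
      \<comment> \<open>Distinct sets of equal finite size are not nested.\<close>
      have "\<not> S' \<subseteq> S"
        using J(2,3) S that card_subset_eq by metis
      then show ?thesis using J(1)[OF that(1)] by (auto simp: edge_def)
    qed
    then show "transversal V (E - {edge m f S}) ({1..m} - S)"
      using q(3) by (auto simp: transversal_def E_def V_def)
    show "card ({1..m} - S) = l"
      using J[OF S] m assms(1) by (simp add: card_Diff_subset)
  qed
  obtain S0 where S0: "S0 \<in> ?J" using extend[of "{}"] by auto
  have tauE: "tau V E = l + 1"
  proof (rule tau_eqI)
    have fS0: "m + 1 + f S0 \<in> V" using edge_sub[OF S0] by (auto simp: edge_def)
    \<comment> \<open>The complement of \<open>S0\<close> misses only the edge of \<open>S0\<close>,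
      which the colour vertex of \<open>S0\<close> repairs.\<close>
    show "transversal V E (insert (m + 1 + f S0) ({1..m} - S0))"
      using compl(1)[OF S0] fS0 by (auto simp: transversal_def edge_def)
    show "card (insert (m + 1 + f S0) ({1..m} - S0)) = l + 1"
      using compl(2)[OF S0] by simp
    show "l + 1 \<le> card T" if T: "transversal V E T" for T
    proof (rule ccontr)
      assume "\<not> l + 1 \<le> card T"
      moreover have "transversal V (E - {edge m f S0}) T"
        using T by (auto simp: transversal_def)
      ultimately have "T = {1..m} - S0" using small[OF S0] by simp
      moreover have "T \<inter> edge m f S0 \<noteq> {}"
        using T S0 by (auto simp: transversal_def E_def)
      ultimately show False by (auto simp: edge_def)
    qed
  qed
  have tau_del: "tau V (E - {edge m f S}) = l" if S: "S \<in> ?J" for S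
  proof (rule tau_eqI[OF compl[OF S]])
    \<comment> \<open>A transversal with at most \<open>l\<close> elements is the complement of
      \<open>S\<close>, which has exactly \<open>l\<close>.\<close>
    show "l \<le> card T" if "transversal V (E - {edge m f S}) T" for T
      using small[OF S that] compl(2)[OF S] by (cases "card T \<le> l") auto
  qed
  have "\<exists>!T. minimum_transversal V (E - {edge m f S}) T" if S: "S \<in> ?J" for S
    unfolding minimum_transversal_def tau_del[OF S]
  proof (rule ex1I)
    show "transversal V (E - {edge m f S}) ({1..m} - S) \<and> card ({1..m} - S) = l"
      using compl[OF S] by blast
    show "T = {1..m} - S" if "transversal V (E - {edge m f S}) T \<and> card T = l" for T
      using small[OF S, of T] that by simp
  qed
  then have "uniquely_tau_critical V E"
    using tauE tau_del by (auto simp: uniquely_tau_critical_def tau_critical_def E_def)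
  moreover have "card V = n" by (simp add: V_def)
  ultimately show ?thesis using hyp uni iso tauE by blast
qed

end
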